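(* Let $\mathcal{C}_1=\langle g_1(x)\rangle$ and $\mathcal{C}_2=\langle g_2(x)\rangle$ be binary cyclic codes of length $p$ with generator polynomials $g_1(x)$ and $g_2(x)$, such that $\mathcal{C}_2^{\perp}\subseteq\mathcal{C}_2 \subset \mathcal{C}_1$ and $\mathcal{C}_1 \neq \mathcal{C}_2$. Define $f(x)\in\mathbb{F}_2[x]$ to be the polynomial such that $g_2(x)=f(x)g_1(x)$. If $p$ is a prime, then $\operatorname{ord}\left(f(x)\right)=p$.
   Context: A binary cyclic code of length $n$ is a linear subspace $\mathcal{C}\subseteq\mathbb{F}_2^n$ closed under cyclic shifts. Identifying a vector $(c_0,\dots,c_{n-1})$ with the polynomial $\sum_i c_i x^i$, it is an ideal of $\mathbb{F}_2[x]/(x^n-1)$, and its generator polynomial is the unique monic divisor $g(x)$ of $x^n-1$ in $\mathbb{F}_2[x]$ with $\mathcal{C}=\langle g(x)\rangle$ (so $\deg g = n-\dim\mathcal{C}$). The dual code is $\mathcal{C}^{\perp}=\{\mathbf{c}'\in\mathbb{F}_2^n \mid \mathbf{c}'\cdot\mathbf{c}=0 \text{ for all } \mathbf{c}\in\mathcal{C}\}$. For cyclic codes $\mathcal{C}_2\subseteq\mathcal{C}_1$ of the same length, $g_1(x)$ divides $g_2(x)$. For $f(x)\in\mathbb{F}_2[x]$ with $f(0)=1$, the order $\operatorname{ord}(f(x))$ is the cardinality of the set $\{x^a \bmod f(x) \mid a\in\mathbb{N}\}$, where $\mathbb{N}$ is the set of positive integers.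
   Formalization: The prime p is assumed to be different from 2: for p = 2 the claim fails, with C_1 = F_2^2 and C_2 = {00, 11}, where f(x) = x + 1 has order 1. *)

theory Defs
  imports
    "HOL-Library.Z2"
    "HOL-Computational_Algebra.Polynomial"
    "HOL-Computational_Algebra.Primes"
    "Jordan_Normal_Form.VS_Connect"
begin

(* The field F_2 is the type bit, and F_2^n is carrier_vec n :: bit vec set. *)

(* (c_0, ..., c_(n-1)) is sent to (c_(n-1), c_0, ..., c_(n-2)). *)
definition cyclic_shift :: "'a vec \<Rightarrow> 'a vec" where
  "cyclic_shift c = vec (dim_vec c) (\<lambda>i. c $ ((i + dim_vec c - 1) mod dim_vec c))"

definition binary_cyclic_code :: "nat \<Rightarrow> bit vec set \<Rightarrow> bool" where
  "binary_cyclic_code n C \<longleftrightarrow>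
     VectorSpace.subspace class_ring C (module_vec TYPE(bit) n) \<and>
     (\<forall>c\<in>C. cyclic_shift c \<in> C)"

definition dual_code :: "nat \<Rightarrow> bit vec set \<Rightarrow> bit vec set" where
  "dual_code n C = {c' \<in> carrier_vec n. \<forall>c\<in>C. c' \<bullet> c = 0}"

definition code_poly :: "bit vec \<Rightarrow> bit poly" where
  "code_poly c = (\<Sum>i<dim_vec c. monom (c $ i) i)"

(* Elements of F_2[x]/(x^n - 1) are represented by their remainders modulo x^n - 1,
   so this is the ideal generated by the class of g, read as a set of vectors. *)
definition cyclic_ideal :: "nat \<Rightarrow> bit poly \<Rightarrow> bit vec set" where
  "cyclic_ideal n g =
     {c \<in> carrier_vec n. \<exists>q. code_poly c = (q * g) mod (monom 1 n - 1)}"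

definition generator_polynomial :: "nat \<Rightarrow> bit poly \<Rightarrow> bit vec set \<Rightarrow> bool" where
  "generator_polynomial n g C \<longleftrightarrow>
     lead_coeff g = 1 \<and> g dvd (monom 1 n - 1) \<and> C = cyclic_ideal n g"

(* Exponents are positive. For f \<noteq> 0 the set of remainders is finite, so card is its
   true cardinality. *)
definition poly_ord :: "bit poly \<Rightarrow> nat" where
  "poly_ord f = card {monom 1 a mod f | a :: nat. a > 0}"

(* The theorem is stated for odd primes because it fails in length 2: for C1 = F_2^2 and
   C2 = {00, 11}, which is its own dual, f = x + 1 and poly_ord f = 1. *)

end

(* Every x^a mod f with a > 0 is determined by a mod p, because f divides x^p - 1. If two of these
   p residues coincided, then x^d = 1 modulo f for some 0 < d < p, and Bezout would give x = 1
   modulo f; as f is not constant, f = x - 1 and so g_2(1) = 0. But then every word of C_2 has even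
   weight, so the all-ones word lies in the dual of C_2, hence in C_2, although its weight p is
   odd. *)
theory Submission
  imports Defs "HOL-Number_Theory.Cong"
begin

lemma poly_code_poly_1: "poly (code_poly c) 1 = (\<Sum>i<dim_vec c. c $ i)"
  by (simp only: code_poly_def poly_sum poly_monom power_one mult_1_right)

lemma poly_mod_at_root:
  fixes a b :: "'a :: field poly"
  assumes "poly b x = 0"
  shows "poly (a mod b) x = poly a x"
  using arg_cong[OF mod_mult_div_eq[of a b], of "\<lambda>q. poly q x"]
  unfolding poly_add poly_mult assms by simp

text \<open>Since 1 is a root of \<open>monom 1 n - 1\<close>, reduction modulo this polynomial
  preserves values at 1, so the root 1 of \<open>g\<close> passes to every codeword.\<close>

lemma cyclic_ideal_poly_1_eq_0:
  assumes "c \<in> cyclic_ideal n g" and "poly g 1 = 0"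
  shows "poly (code_poly c) 1 = 0"
proof -
  obtain q where q: "code_poly c = (q * g) mod (monom 1 n - 1)"
    using assms(1) by (auto simp: cyclic_ideal_def)
  have "poly (monom 1 n - 1 :: bit poly) 1 = 0"
    by (simp add: poly_monom)
  then show ?thesis
    unfolding q by (simp add: poly_mod_at_root assms(2))
qed

lemma generator_poly_1_neq_0:
  assumes "odd n" and gen: "generator_polynomial n g C" and dual: "dual_code n C \<subseteq> C"
  shows "poly g 1 \<noteq> 0"
proof
  assume g: "poly g 1 = 0"
  let ?j = "vec n (\<lambda>_. 1 :: bit)"
  have C: "C = cyclic_ideal n g"
    using gen by (simp add: generator_polynomial_def)
  have "?j \<bullet> c = 0" if "c \<in> C" for c
  proof -
    have "c \<in> carrier_vec n"
      using that by (simp add: C cyclic_ideal_def)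
    \<comment> \<open>Both sides are the sum of the coordinates of \<open>c\<close>, that is, the
      parity of its weight.\<close>
    then have "?j \<bullet> c = poly (code_poly c) 1"
      unfolding poly_code_poly_1 scalar_prod_def atLeast0LessThan by (intro sum.cong) auto
    then show ?thesis
      using cyclic_ideal_poly_1_eq_0[of c n g] that g C by simp
  qed
  then have "?j \<in> C"
    using dual by (auto simp: dual_code_def)
  then have "poly (code_poly ?j) 1 = 0"
    using cyclic_ideal_poly_1_eq_0[of ?j n g] g C by simp
  \<comment> \<open>The all-ones word has value \<open>n\<close> at 1, which in F_2 is the parity of
    \<open>n\<close>.\<close>
  then have "(of_nat n :: bit) = 0"
    by (simp add: poly_code_poly_1)
  then show False
    using \<open>odd n\<close> by (auto elim!: oddE)
qed

text \<open>Bezout over the naturals: with k u = n v + gcd k n, the power x^(gcd k n) is congruent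
  to (x^n)^v x^(gcd k n) = (x^k)^u, hence to 1. Positivity of \<open>k\<close> allows this
  subtraction-free form.\<close>

lemma cong_power_gcd_1:
  fixes x m :: "'a :: unique_euclidean_ring"
  assumes "[x ^ k = 1] (mod m)" and "[x ^ n = 1] (mod m)" and "k > 0"
  shows "[x ^ gcd k n = 1] (mod m)"
proof -
  obtain u v where uv: "k * u = n * v + gcd k n"
    using bezout_nat[of k n] \<open>k > 0\<close> by auto
  have "[(x ^ n) ^ v * x ^ gcd k n = 1 ^ v * x ^ gcd k n] (mod m)"
    using assms(2) by (intro cong_mult cong_pow) auto
  moreover have "(x ^ n) ^ v * x ^ gcd k n = (x ^ k) ^ u"
    by (simp add: uv power_add flip: power_mult)
  moreover have "[(x ^ k) ^ u = 1 ^ u] (mod m)"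
    using assms(1) by (rule cong_pow)
  ultimately show ?thesis
    by (metis cong_sym cong_trans mult_1 power_one)
qed

text \<open>Modulo \<open>m\<close>, the power x^((n - 1) a) is an inverse of x^a, because their
  product is (x^n)^a. Multiplying both sides by it cancels x^a.\<close>

lemma cong_power_cancel:
  fixes x m :: "'a :: unique_euclidean_ring"
  assumes "[x ^ n = 1] (mod m)" and "n > 0" and "a \<le> b" and "[x ^ a = x ^ b] (mod m)"
  shows "[x ^ (b - a) = 1] (mod m)"
proof -
  have na: "n * a = a + (n - 1) * a"
    using \<open>n > 0\<close> by (cases n) auto
  have one: "[x ^ (n * a) = 1] (mod m)"
    using cong_pow[OF assms(1), of a] by (simp add: power_mult)
  have "[x ^ a * x ^ ((n - 1) * a) = x ^ b * x ^ ((n - 1) * a)] (mod m)"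
    using assms(4) by (rule cong_mult) auto
  moreover have "x ^ b * x ^ ((n - 1) * a) = x ^ (b - a) * x ^ (n * a)"
    using \<open>a \<le> b\<close> unfolding na by (simp flip: power_add)
  moreover have "x ^ a * x ^ ((n - 1) * a) = x ^ (n * a)"
    unfolding na by (simp add: power_add)
  moreover have "[x ^ (b - a) * x ^ (n * a) = x ^ (b - a) * 1] (mod m)"
    using one by (intro cong_mult) auto
  ultimately show ?thesis
    using one by (metis cong_sym cong_trans mult.right_neutral)
qed

text \<open>The multiplicative order of \<open>x\<close> modulo \<open>m\<close> divides the prime
  \<open>p\<close> and is not 1, so it is \<open>p\<close>; the exponents 0, ..., p - 1 then
  represent each power exactly once.\<close>

lemma card_powers_mod_prime:
  fixes x m :: "'a :: unique_euclidean_ring"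
  assumes "prime p" and xp: "[x ^ p = 1] (mod m)" and x: "\<not> [x = 1] (mod m)"
  shows "card {x ^ a mod m | a :: nat. a > 0} = p"
proof -
  have p: "p > 0"
    using \<open>prime p\<close> by (rule prime_gt_0_nat)
  have distinct: "x ^ a mod m \<noteq> x ^ b mod m" if "a < b" "b < p" for a b
  proof
    assume "x ^ a mod m = x ^ b mod m"
    then have "[x ^ (b - a) = 1] (mod m)"
      using that cong_power_cancel[OF xp p, of a b] by (simp add: cong_def)
    then have "[x ^ gcd (b - a) p = 1] (mod m)"
      using that xp by (intro cong_power_gcd_1) auto
    \<comment> \<open>Here 0 < b - a < p, so the prime \<open>p\<close> does not divide
      \<open>b - a\<close>.\<close>
    moreover have "gcd (b - a) p = 1"
      using prime_imp_coprime[OF \<open>prime p\<close>, of "b - a"] that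
      by (metis coprime_iff_gcd_eq_1 gcd.commute less_imp_diff_less linorder_not_less
          nat_dvd_not_less zero_less_diff)
    ultimately show False
      using x by simp
  qed
  have red: "x ^ a mod m = x ^ (a mod p) mod m" for a
  proof -
    have "[(x ^ p) ^ (a div p) * x ^ (a mod p) = 1 ^ (a div p) * x ^ (a mod p)] (mod m)"
      using xp by (intro cong_mult cong_pow) auto
    then show ?thesis
      by (simp add: cong_def flip: power_mult power_add)
  qed
  have "{x ^ a mod m | a :: nat. a > 0} = (\<lambda>a. x ^ a mod m) ` {..<p}" (is "?L = ?R")
  proof
    show "?L \<subseteq> ?R"
      using p red by fastforce
    \<comment> \<open>The left-hand set admits only positive exponents; shifting by \<open>p\<close>
      provides one for the residue of x^0.\<close>
    have "x ^ a mod m = x ^ (a + p) mod m" for a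
      using red[of a] red[of "a + p"] by simp
    then show "?R \<subseteq> ?L"
      using p by fastforce
  qed
  moreover have "inj_on (\<lambda>a. x ^ a mod m) {..<p}"
    by (rule linorder_inj_onI) (auto dest: distinct)
  ultimately show ?thesis
    by (simp add: card_image)
qed

lemma bit_poly_degree_0:
  fixes f :: "bit poly"
  assumes "degree f = 0" and "f \<noteq> 0"
  shows "f = 1"
proof -
  obtain c where "f = [:c:]"
    using assms(1) by (rule degree_eq_zeroE)
  then show ?thesis
    using assms(2) by (cases c) (auto simp: one_pCons)
qed

text \<open>Degrees add up to 1, so the cofactor of a nonconstant \<open>f\<close> is a nonzero
  constant, and evaluating the factorization at \<open>a\<close> forces \<open>f\<close> to vanish
  there.\<close>

lemma dvd_linear_imp_root:
  fixes f :: "'a :: field poly"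
  assumes "f dvd [:- a, 1:]" and "degree f \<noteq> 0"
  shows "poly f a = 0"
proof -
  obtain k where k: "[:- a, 1:] = f * k"
    using assms(1) by (elim dvdE)
  then have "f \<noteq> 0" "k \<noteq> 0"
    by auto
  then have "degree f + degree k = 1"
    using k by (metis degree_mult_eq degree_pCons_eq_if degree_1 one_pCons one_neq_zero One_nat_def)
  with assms(2) have "degree k = 0"
    by simp
  then obtain c where c: "k = [:c:]"
    by (rule degree_eq_zeroE)
  have "poly f a * c = 0"
    using arg_cong[OF k, of "\<lambda>q. poly q a"] c by (simp add: mult.commute)
  then show ?thesis
    using \<open>k \<noteq> 0\<close> unfolding c by auto
qed

theorem mainTheorem2:
  fixes p :: nat and C1 C2 :: "bit vec set" and g1 g2 f :: "bit poly"
  assumes "prime p" and "p \<noteq> 2"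
    and "binary_cyclic_code p C1" and "generator_polynomial p g1 C1"
    and "binary_cyclic_code p C2" and "generator_polynomial p g2 C2"
    and "dual_code p C2 \<subseteq> C2" and "C2 \<subseteq> C1" and "C1 \<noteq> C2"
    and "g2 = f * g1"
  shows "poly_ord f = p"
proof -
  let ?x = "monom 1 1 :: bit poly"
  have pow: "?x ^ a = monom 1 a" for a
    by (simp add: monom_power)
  have "odd p"
    using assms(1,2) prime_odd_nat prime_ge_2_nat[of p] by fastforce
  have "f \<noteq> 0"
    using assms(6,10) by (auto simp: generator_polynomial_def)
  \<comment> \<open>If \<open>f = 1\<close>, both codes are generated by the same polynomial and
    coincide.\<close>
  moreover have "f \<noteq> 1"
    using assms(4,6,9,10) by (auto simp: generator_polynomial_def)
  ultimately have "degree f \<noteq> 0"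
    using bit_poly_degree_0 by blast
  have "f dvd monom 1 p - 1"
    using assms(6,10) by (auto simp: generator_polynomial_def intro: dvd_mult_left)
  then have "[?x ^ p = 1] (mod f)"
    unfolding pow by (simp add: cong_iff_dvd_diff)
  moreover have "\<not> [?x = 1] (mod f)"
  proof
    assume "[?x = 1] (mod f)"
    moreover have "?x - 1 = [:- 1, 1:]"
      by (simp add: monom_altdef one_pCons)
    ultimately have "poly f 1 = 0"
      using \<open>degree f \<noteq> 0\<close> by (intro dvd_linear_imp_root) (simp_all add: cong_iff_dvd_diff)
    then have "poly g2 1 = 0"
      using assms(10) by simp
    with generator_poly_1_neq_0[OF \<open>odd p\<close> assms(6,7)] show False ..
  qed
  ultimately show ?thesis
    using card_powers_mod_prime[OF assms(1), of ?x f] unfolding poly_ord_def pow by blast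
qed

end
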